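(* Let $g>0$, let $E_1,E_2,E_3$ be the canonical basis of $\mathbb{R}^3$, and let $B=(B_1,0,B_3)^T$ with $B_1>0$. Let $\omega,a:[0,\infty)\to\mathbb{R}^3$ be continuous, let $R:[0,\infty)\to\mathrm{SO}(3)$ satisfy $\dot R=RS(\omega)$, and set $\gamma:=gR^TE_3$ and $\beta:=R^TB$. Let $v:[0,\infty)\to\mathbb{R}^3$ satisfy $\dot v=v\times\omega+\gamma+a$. Let $K,L,M\in\mathbb{R}^{3\times3}$ be constant matrices whose symmetric parts are positive definite, and let $(\hat v,\hat\gamma,\hat\beta)$ be a solution, with arbitrary initial condition in $\mathbb{R}^3\times\mathbb{R}^3\times\mathbb{R}^3$, of $$\dot{\hat v}=\hat v\times\omega+a+\hat\gamma-(L+K)(\hat v-v),$$ $$\dot{\hat\gamma}=\hat\gamma\times\omega-\bigl(LS(\omega)-S(\omega)L+LK\bigr)(\hat v-v),$$ $$\dot{\hat\beta}=\hat\beta\times\omega-M(\hat\beta-\beta).$$ Then the matrix $$\tilde R:=\begin{pmatrix}\dfrac{(\hat\gamma\times\hat\beta)\times\hat\gamma}{|(gE_3\times B)\times gE_3|}&\dfrac{\hat\gamma\times\hat\beta}{|gE_3\times B|}&\dfrac{\hat\gamma}{|gE_3|}\end{pmatrix}^T$$ (the transpose of the $3\times3$ matrix with the indicated columns) globally exponentially converges to $R$.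
   Context: Here $\times$ is the cross product on $\mathbb{R}^3$, $|\cdot|$ is the Euclidean norm, and for $w\in\mathbb{R}^3$, $S(w)$ is the skew-symmetric $3\times3$ matrix with $S(w)x=w\times x$ for all $x\in\mathbb{R}^3$. The symmetric part of a matrix $A$ is $\frac{A+A^T}{2}$. "$\tilde R$ globally exponentially converges to $R$" means: there is $\lambda>0$, independent of the initial conditions, such that for every initial condition of the observer there is $C>0$ with $\|\tilde R(t)-R(t)\|\le Ce^{-\lambda t}$ for all $t\ge0$ (any matrix norm). Interpretation: $R$ is the orientation of a rigid body, $E_1,E_2,E_3$ is the North-East-Down frame, $gE_3$ is the gravity vector and $B$ is the constant magnetic vector in that frame. *)

theory Defs
  imports "HOL-Analysis.Analysis"
begin

abbreviation E3 :: "real^3" where "E3 \<equiv> axis 3 1"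

definition SO3 :: "(real^3^3) set" where
  "SO3 = {A. orthogonal_matrix A \<and> det A = 1}"

definition skew :: "real^3 \<Rightarrow> real^3^3" where
  "skew w = matrix (cross3 w)"

lemma skew_mult_vec: "skew w *v x = cross3 w x"
  by (simp add: skew_def matrix_def matrix_vector_mult_def vec_eq_iff forall_3 sum_3 cross3_def axis_def)

lemma transpose_skew: "transpose (skew w) = - skew w"
  by (simp add: skew_def matrix_def transpose_def vec_eq_iff forall_3 cross3_def axis_def)

definition sym_part :: "real^3^3 \<Rightarrow> real^3^3" where
  "sym_part A = (1/2) *\<^sub>R (A + transpose A)"

definition positive_definite :: "real^3^3 \<Rightarrow> bool" where
  "positive_definite P \<longleftrightarrow> transpose P = P \<and> (\<forall>x. x \<noteq> 0 \<longrightarrow> x \<bullet> (P *v x) > 0)"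

definition matrix_of_columns :: "real^3 \<Rightarrow> real^3 \<Rightarrow> real^3 \<Rightarrow> real^3^3" where
  "matrix_of_columns c1 c2 c3 =
     (\<chi> i j. if j = 1 then c1 $ i else if j = 2 then c2 $ i else c3 $ i)"

lemma columns_matrix_of_columns:
  "column 1 (matrix_of_columns c1 c2 c3) = c1"
  "column 2 (matrix_of_columns c1 c2 c3) = c2"
  "column 3 (matrix_of_columns c1 c2 c3) = c3"
  by (simp_all add: matrix_of_columns_def column_def vec_eq_iff)

text \<open>Derivatives are taken within \<open>{0..}\<close>, so they are one-sided at \<open>0\<close>.\<close>

definition observer_solution ::
  "real^3^3 \<Rightarrow> real^3^3 \<Rightarrow> real^3^3 \<Rightarrow>
   (real \<Rightarrow> real^3) \<Rightarrow> (real \<Rightarrow> real^3) \<Rightarrow> (real \<Rightarrow> real^3) \<Rightarrow> (real \<Rightarrow> real^3) \<Rightarrow>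
   (real \<Rightarrow> real^3) \<Rightarrow> (real \<Rightarrow> real^3) \<Rightarrow> (real \<Rightarrow> real^3) \<Rightarrow> bool" where
  "observer_solution K L M \<omega> a v \<beta> vh \<gamma>h \<beta>h \<longleftrightarrow>
     (\<forall>t\<ge>0.
        (vh has_vector_derivative
           cross3 (vh t) (\<omega> t) + a t + \<gamma>h t - (L + K) *v (vh t - v t)) (at t within {0..}) \<and>
        (\<gamma>h has_vector_derivative
           cross3 (\<gamma>h t) (\<omega> t)
           - (L ** skew (\<omega> t) - skew (\<omega> t) ** L + L ** K) *v (vh t - v t)) (at t within {0..}) \<and>
        (\<beta>h has_vector_derivative
           cross3 (\<beta>h t) (\<omega> t) - M *v (\<beta>h t - \<beta> t)) (at t within {0..}))"

definition attitude_estimate :: "real \<Rightarrow> real^3 \<Rightarrow> real^3 \<Rightarrow> real^3 \<Rightarrow> real^3^3" where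
  "attitude_estimate g B c b =
     transpose (matrix_of_columns
       (cross3 (cross3 c b) c /\<^sub>R norm (cross3 (cross3 (g *\<^sub>R E3) B) (g *\<^sub>R E3)))
       (cross3 c b /\<^sub>R norm (cross3 (g *\<^sub>R E3) B))
       (c /\<^sub>R norm (g *\<^sub>R E3)))"

end

theory Submission
  imports Defs
begin

text \<open>
  With \<open>e = vh - v\<close>, \<open>p = \<gamma>h - \<gamma>\<close> and \<open>z = p - L e\<close> the error system becomes the cascade
  \<open>z' = z \<times> \<omega> - L z\<close>, \<open>e' = e \<times> \<omega> + z - K e\<close>, and \<open>q = \<beta>h - \<beta>\<close> satisfies
  \<open>q' = q \<times> \<omega> - M q\<close>. The terms in \<open>\<omega>\<close> do not contribute to derivatives of squared norms, so if \<open>m\<close> bounds the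
  quadratic forms of \<open>K\<close>, \<open>L\<close>, \<open>M\<close> from below, then \<open>|z|\<^sup>2/m\<^sup>2 + |e|\<^sup>2\<close> and \<open>|q|\<^sup>2\<close> decay exponentially
  whatever \<open>\<omega>\<close> is. The estimate is polynomial in \<open>(\<gamma>h, \<beta>h)\<close>, it equals \<open>R\<close> at \<open>(\<gamma>, \<beta>)\<close>, and
  \<open>\<gamma>\<close>, \<open>\<beta>\<close> have constant norm, hence the decay carries over.
\<close>

section \<open>Differential inequalities and quadratic forms\<close>

text \<open>The integrating factor \<open>exp (c * t)\<close> turns the differential inequality into
  monotone decrease of the product.\<close>

lemma exponential_decay:
  fixes u u' :: "real \<Rightarrow> real"
  assumes deriv: "\<And>t. t \<ge> 0 \<Longrightarrow> (u has_vector_derivative u' t) (at t within {0..})"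
    and le: "\<And>t. t \<ge> 0 \<Longrightarrow> u' t \<le> - c * u t"
    and "t \<ge> 0"
  shows "u t \<le> u 0 * exp (- c * t)"
proof -
  define w where "w = (\<lambda>t. u t * exp (c * t))"
  have w: "(w has_real_derivative (u' x + c * u x) * exp (c * x)) (at x within {0..})"
    if "x \<ge> 0" for x
    unfolding w_def
    using deriv[OF that]
    by (auto simp: has_real_derivative_iff_has_vector_derivative [symmetric] algebra_simps
        intro!: derivative_eq_intros)
  \<comment> \<open>At 0 the derivative is only one-sided, so the monotonicity criterion uses
    derivatives on the open interval and continuity on the closed one.\<close>
  have "w t \<le> w 0"
  proof (rule DERIV_nonpos_imp_decreasing_open[OF \<open>t \<ge> 0\<close>])
    fix x assume "0 < x" "x < t"
    then have "at x within {0..} = at x"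
      by (intro at_within_interior) simp
    moreover have "(u' x + c * u x) * exp (c * x) \<le> 0"
      using le[of x] \<open>0 < x\<close> by (intro mult_nonpos_nonneg) auto
    ultimately show "\<exists>y. DERIV w x :> y \<and> y \<le> 0"
      using w[of x] \<open>0 < x\<close> by auto
  next
    have "continuous_on {0..} w"
      by (rule DERIV_continuous_on[OF w]) simp
    then show "continuous_on {0..t} w"
      by (rule continuous_on_subset) auto
  qed
  then show ?thesis
    by (simp add: w_def exp_minus field_simps)
qed

text \<open>A matrix and its transpose have the same quadratic form; positivity of the symmetric
  part thus passes to the matrix itself.\<close>

lemma inner_sym_part: "x \<bullet> (sym_part A *v x) = x \<bullet> (A *v x)"
proof -
  have "x \<bullet> (transpose A *v x) = x \<bullet> (A *v x)"
    by (metis dot_lmul_matrix inner_commute transpose_matrix_vector)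
  then show ?thesis
    by (simp add: sym_part_def scaleR_matrix_vector_assoc [symmetric]
        matrix_vector_mult_add_rdistrib inner_add_right)
qed

text \<open>The minimum of the quadratic form over the compact unit sphere serves as
  \<open>m\<close>; homogeneity of degree 2 extends the bound to all vectors.\<close>

lemma positive_definite_coercive:
  assumes "positive_definite (sym_part A)"
  obtains m where "m > 0" "\<And>x. m * (norm x)\<^sup>2 \<le> x \<bullet> (A *v x)"
proof -
  let ?f = "\<lambda>x. x \<bullet> (A *v x)"
  have ne: "sphere (0::real^3) 1 \<noteq> {}"
    by (metis empty_iff mem_sphere_0 norm_axis_1)
  have "continuous_on (sphere 0 1) ?f"
    by (intro continuous_intros)
  then obtain y where y: "y \<in> sphere 0 1" "\<And>x. x \<in> sphere 0 1 \<Longrightarrow> ?f y \<le> ?f x"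
    using continuous_attains_inf[OF compact_sphere ne] by blast
  have "?f y > 0"
    using assms y(1) unfolding positive_definite_def inner_sym_part by (metis mem_sphere_0 norm_zero zero_neq_one)
  moreover have "?f y * (norm x)\<^sup>2 \<le> ?f x" for x
  proof (cases "x = 0")
    case False
    have "?f y \<le> ?f (x /\<^sub>R norm x)"
      using False by (intro y(2)) simp
    also have "\<dots> = ?f x / (norm x)\<^sup>2"
      by (simp add: matrix_vector_mult_scaleR power2_eq_square divide_simps)
    finally show ?thesis
      using False by (simp add: field_simps)
  qed simp
  ultimately show ?thesis
    using that by blast
qed

text \<open>Lagrange's identity: the squares of cross and dot product add up to the squared product
  of the norms.\<close>

lemma norm_cross_le: "norm (cross3 x y) \<le> norm x * norm y"
proof (rule power2_le_imp_le)
  show "(norm (cross3 x y))\<^sup>2 \<le> (norm x * norm y)\<^sup>2"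
    using norm_cross_dot[of x y] zero_le_power2[of "x \<bullet> y"] by linarith
qed simp

lemma norm_squared_derivative:
  fixes x :: "real \<Rightarrow> 'a::real_inner"
  assumes "(x has_vector_derivative x') (at t within S)"
  shows "((\<lambda>t. (norm (x t))\<^sup>2) has_vector_derivative 2 * (x t \<bullet> x')) (at t within S)"
  using bounded_bilinear.has_vector_derivative[OF bounded_bilinear_inner assms assms]
  by (simp add: power2_norm_eq_inner inner_commute)

section \<open>Decay of the error systems\<close>

text \<open>The cross product is orthogonal to \<open>x t\<close>, so only the form of
  \<open>A\<close> enters the derivative of the squared norm. That square decays at rate
  \<open>2 * m\<close>, the norm at rate \<open>m\<close>.\<close>

lemma rotating_decay:
  fixes x \<omega> :: "real \<Rightarrow> real^3"
  assumes deriv: "\<And>t. t \<ge> 0 \<Longrightarrow>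
      (x has_vector_derivative cross3 (x t) (\<omega> t) - A *v x t) (at t within {0..})"
    and coercive: "\<And>y. m * (norm y)\<^sup>2 \<le> y \<bullet> (A *v y)"
    and "t \<ge> 0"
  shows "norm (x t) \<le> norm (x 0) * exp (- m * t)"
proof -
  have "(norm (x t))\<^sup>2 \<le> (norm (x 0))\<^sup>2 * exp (- (2 * m) * t)"
  proof (rule exponential_decay[OF norm_squared_derivative[OF deriv] _ \<open>t \<ge> 0\<close>])
    show "2 * (x t \<bullet> (cross3 (x t) (\<omega> t) - A *v x t)) \<le> - (2 * m) * (norm (x t))\<^sup>2" for t
      using coercive[of "x t"] by (simp add: inner_diff_right dot_cross_self)
  qed
  also have "\<dots> = (norm (x 0) * exp (- m * t))\<^sup>2"
    by (simp add: power_mult_distrib exp_double [symmetric] mult.assoc)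
  finally show ?thesis
    by (rule power2_le_imp_le) simp
qed

text \<open>The weight \<open>1 / m\<^sup>2\<close> balances the two dissipation terms: Young's
  inequality lets the coupling of \<open>e\<close> and \<open>z\<close> consume half of each, and
  the remaining halves give the rate \<open>m\<close>.\<close>

lemma cascade_decay:
  fixes e z \<omega> :: "real \<Rightarrow> real^3"
  assumes e: "\<And>t. t \<ge> 0 \<Longrightarrow>
      (e has_vector_derivative cross3 (e t) (\<omega> t) + z t - K *v e t) (at t within {0..})"
    and z: "\<And>t. t \<ge> 0 \<Longrightarrow>
      (z has_vector_derivative cross3 (z t) (\<omega> t) - L *v z t) (at t within {0..})"
    and K: "\<And>y. m * (norm y)\<^sup>2 \<le> y \<bullet> (K *v y)"
    and L: "\<And>y. m * (norm y)\<^sup>2 \<le> y \<bullet> (L *v y)"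
    and "m > 0" "t \<ge> 0"
  shows "(norm (z t))\<^sup>2 / m\<^sup>2 + (norm (e t))\<^sup>2 \<le>
    ((norm (z 0))\<^sup>2 / m\<^sup>2 + (norm (e 0))\<^sup>2) * exp (- m * t)"
proof (rule exponential_decay[OF _ _ \<open>t \<ge> 0\<close>])
  fix t :: real assume "t \<ge> 0"
  show "((\<lambda>t. (norm (z t))\<^sup>2 / m\<^sup>2 + (norm (e t))\<^sup>2) has_vector_derivative
      2 * (z t \<bullet> (cross3 (z t) (\<omega> t) - L *v z t)) / m\<^sup>2
      + 2 * (e t \<bullet> (cross3 (e t) (\<omega> t) + z t - K *v e t))) (at t within {0..})"
    using \<open>t \<ge> 0\<close>
    by (intro has_vector_derivative_add norm_squared_derivative e
        bounded_linear.has_vector_derivative[OF bounded_linear_divide] z)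
next
  fix t :: real
  have "0 \<le> (norm (z t - m *\<^sub>R e t))\<^sup>2"
    by simp
  also have "\<dots> = (norm (z t))\<^sup>2 - m * (2 * (e t \<bullet> z t)) + m\<^sup>2 * (norm (e t))\<^sup>2"
    unfolding power2_norm_eq_inner
    by (simp add: inner_diff_left inner_diff_right inner_commute power2_eq_square algebra_simps)
  finally have young: "2 * (e t \<bullet> z t) \<le> m * ((norm (z t))\<^sup>2 / m\<^sup>2) + m * (norm (e t))\<^sup>2"
    using \<open>m > 0\<close> by (simp add: field_simps power2_eq_square)
  \<comment> \<open>Naming the quotients makes the remaining estimate linear in its atoms.\<close>
  define zz where "zz = m * ((norm (z t))\<^sup>2 / m\<^sup>2)"
  define zLz where "zLz = (z t \<bullet> (L *v z t)) / m\<^sup>2"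
  have "zz \<le> zLz"
    using L[of "z t"] by (simp add: zz_def zLz_def divide_right_mono)
  moreover have "2 * (z t \<bullet> (cross3 (z t) (\<omega> t) - L *v z t)) / m\<^sup>2 = - 2 * zLz"
    by (simp add: zLz_def inner_diff_right dot_cross_self)
  moreover have "e t \<bullet> (cross3 (e t) (\<omega> t) + z t - K *v e t) = e t \<bullet> z t - e t \<bullet> (K *v e t)"
    by (simp add: inner_diff_right inner_add_right dot_cross_self)
  moreover have "- m * ((norm (z t))\<^sup>2 / m\<^sup>2 + (norm (e t))\<^sup>2) = - zz - m * (norm (e t))\<^sup>2"
    by (simp add: zz_def algebra_simps)
  ultimately show "2 * (z t \<bullet> (cross3 (z t) (\<omega> t) - L *v z t)) / m\<^sup>2
      + 2 * (e t \<bullet> (cross3 (e t) (\<omega> t) + z t - K *v e t))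
      \<le> - m * ((norm (z t))\<^sup>2 / m\<^sup>2 + (norm (e t))\<^sup>2)"
    using young K[of "e t"] unfolding zz_def [symmetric] by argo
qed

section \<open>Recovering the attitude from two directions\<close>

lemma SO3_cross:
  assumes "A \<in> SO3"
  shows "cross3 (transpose A *v x) (transpose A *v y) = transpose A *v (cross3 x y)"
  using assms unfolding SO3_def
  by (intro cross_rotation_matrix) (auto simp: rotation_matrix_def)

lemma SO3_norm:
  assumes "A \<in> SO3"
  shows "norm (transpose A *v x) = norm x"
  using assms unfolding SO3_def
  by (metis (mono_tags) mem_Collect_eq orthogonal_matrix_transpose orthogonal_transformation_matrix
      matrix_of_matrix_vector_mul matrix_vector_mul_linear orthogonal_transformation)

text \<open>Rotations commute with cross products, so the normalised columns are
  \<open>transpose A\<close> applied to the North, East and Down axes. These are the rows of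
  \<open>A\<close>, which the outer transpose stacks back into \<open>A\<close>.\<close>

lemma attitude_estimate_true:
  assumes "A \<in> SO3" "g > 0" "B1 > 0" and B: "B = vector [B1, 0, B3]"
  shows "attitude_estimate g B (g *\<^sub>R (transpose A *v E3)) (transpose A *v B) = A"
proof -
  have c: "g *\<^sub>R (transpose A *v E3) = transpose A *v (g *\<^sub>R E3)"
    by (rule matrix_vector_mult_scaleR [symmetric])
  \<comment> \<open>The vertical part of \<open>B\<close> is parallel to gravity and drops out;
    \<open>B1 > 0\<close> fixes the East direction.\<close>
  have east: "cross3 (g *\<^sub>R E3) B = (g * B1) *\<^sub>R axis 2 1"
    by (simp add: B vec_eq_iff forall_3 cross3_def axis_def)
  have north: "cross3 ((g * B1) *\<^sub>R axis 2 1) (g *\<^sub>R E3) = (g\<^sup>2 * B1) *\<^sub>R axis 1 1"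
    by (simp add: cross_mult_left cross_mult_right cross_basis power2_eq_square)
  have col: "(transpose A *v (k *\<^sub>R axis i 1)) /\<^sub>R norm (k *\<^sub>R (axis i 1 :: real^3)) = A $ i"
    if "k > 0" for k i
    using that
    by (simp add: matrix_vector_mult_scaleR matrix_vector_mult_basis column_transpose row_def
        del: transpose_matrix_vector)
  have "matrix_of_columns (A $ 1) (A $ 2) (A $ 3) = transpose A"
    by (simp add: vec_eq_iff forall_3 matrix_of_columns_def transpose_def)
  then show ?thesis
    using assms(2,3)
    unfolding attitude_estimate_def c SO3_cross[OF assms(1)] east north
    by (simp only: col mult_pos_pos zero_less_power transpose_transpose)
qed

section \<open>Stability of the estimate under perturbation\<close>

text \<open>Bilinearity splits the difference. Since \<open>s \<le> 1\<close>, the product of the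
  two perturbations, of order \<open>s\<^sup>2\<close>, is also bounded linearly in
  \<open>s\<close>.\<close>

lemma cross_perturbation:
  assumes "norm (x - x') \<le> P * s" "norm (y - y') \<le> Q * s"
    and "norm x' \<le> X" "norm y' \<le> Y" and s: "0 \<le> s" "s \<le> 1" and "0 \<le> P" "0 \<le> Q"
  shows "norm (cross3 x y - cross3 x' y') \<le> (P * (Y + Q) + X * Q) * s"
proof -
  have "cross3 x y - cross3 x' y' = cross3 (x - x') (y' + (y - y')) + cross3 x' (y - y')"
    by (simp add: Cross3.left_diff_distrib Cross3.right_diff_distrib)
  also have "norm \<dots> \<le> norm (x - x') * (norm y' + norm (y - y')) + norm x' * norm (y - y')"
    by (intro norm_triangle_le add_mono order_trans[OF norm_cross_le] mult_left_mono norm_triangle_ineq) auto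
  also have "\<dots> \<le> (P * s) * (Y + Q) + X * (Q * s)"
  proof (intro add_mono mult_mono)
    show "norm (y - y') \<le> Q"
      using assms(2) mult_left_le[OF s(2) \<open>0 \<le> Q\<close>] by linarith
  qed (use assms norm_ge_zero[of x'] in \<open>auto intro: order_trans[OF norm_ge_zero]\<close>)
  finally show ?thesis
    by (simp add: algebra_simps)
qed

text \<open>Transposition turns the columns into components of the nested vector, whose norm is the
  Euclidean norm of the component norms.\<close>

lemma norm_matrix_of_columns_diff:
  "norm (transpose (matrix_of_columns a b c) - transpose (matrix_of_columns a' b' c'))
    \<le> norm (a - a') + norm (b - b') + norm (c - c')"
proof -
  let ?D = "transpose (matrix_of_columns a b c) - transpose (matrix_of_columns a' b' c')"
  have rows: "?D $ 1 = a - a'" "?D $ 2 = b - b'" "?D $ 3 = c - c'"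
    by (simp_all add: vec_eq_iff transpose_def matrix_of_columns_def)
  have "norm ?D \<le> (\<Sum>i\<in>UNIV. norm (?D $ i))"
    unfolding norm_vec_def[of ?D] by (intro L2_set_le_sum) auto
  then show ?thesis
    by (simp only: sum_3 rows)
qed

lemma attitude_estimate_perturbation:
  fixes X Y P Q :: real
  assumes "0 \<le> X" "0 \<le> Y" "0 \<le> P" "0 \<le> Q"
  obtains C where "C > 0"
    "\<And>c c' b b' s. \<lbrakk>norm (c - c') \<le> P * s; norm (b - b') \<le> Q * s;
        norm c' \<le> X; norm b' \<le> Y; 0 \<le> s; s \<le> 1\<rbrakk>
      \<Longrightarrow> norm (attitude_estimate g B c b - attitude_estimate g B c' b') \<le> C * s"
proof -
  define n1 where "n1 = inverse (norm (cross3 (cross3 (g *\<^sub>R E3) B) (g *\<^sub>R E3)))"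
  define n2 where "n2 = inverse (norm (cross3 (g *\<^sub>R E3) B))"
  define n3 where "n3 = inverse (norm (g *\<^sub>R E3))"
  have n: "n1 \<ge> 0" "n2 \<ge> 0" "n3 \<ge> 0"
    by (simp_all add: n1_def n2_def n3_def)
  \<comment> \<open>\<open>U\<close> and \<open>W\<close> are the constants of
    \<open>cross_perturbation\<close> for the single and the iterated cross product; in
    \<open>W\<close>, \<open>X * Y\<close> bounds the unperturbed inner product vector
    \<open>cross3 c' b'\<close>.\<close>
  define U where "U = P * (Y + Q) + X * Q"
  define W where "W = U * (X + P) + X * Y * P"
  have "U \<ge> 0"
    using assms by (simp add: U_def)
  then have "W \<ge> 0"
    using assms by (simp add: W_def)
  show ?thesis
  proof
    \<comment> \<open>The summand 1 keeps the constant positive when all other terms vanish.\<close>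
    show "n1 * W + n2 * U + n3 * P + 1 > 0"
      using n \<open>U \<ge> 0\<close> \<open>W \<ge> 0\<close> assms by (intro add_nonneg_pos) auto
  next
    fix c c' b b' :: "real^3" and s :: real
    assume c: "norm (c - c') \<le> P * s" and b: "norm (b - b') \<le> Q * s"
      and c': "norm c' \<le> X" and b': "norm b' \<le> Y" and s: "0 \<le> s" "s \<le> 1"
    have u: "norm (cross3 c b - cross3 c' b') \<le> U * s"
      unfolding U_def using c b c' b' s assms by (intro cross_perturbation) auto
    have "norm (cross3 c' b') \<le> X * Y"
      using norm_cross_le[of c' b'] mult_mono[OF c' b'] assms by force
    then have w: "norm (cross3 (cross3 c b) c - cross3 (cross3 c' b') c') \<le> W * s"
      unfolding W_def using u c c' s \<open>U \<ge> 0\<close> assms by (intro cross_perturbation) auto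
    have "norm (attitude_estimate g B c b - attitude_estimate g B c' b')
        \<le> norm (n1 *\<^sub>R cross3 (cross3 c b) c - n1 *\<^sub>R cross3 (cross3 c' b') c')
          + norm (n2 *\<^sub>R cross3 c b - n2 *\<^sub>R cross3 c' b') + norm (n3 *\<^sub>R c - n3 *\<^sub>R c')"
      unfolding attitude_estimate_def n1_def n2_def n3_def by (rule norm_matrix_of_columns_diff)
    also have "\<dots> = n1 * norm (cross3 (cross3 c b) c - cross3 (cross3 c' b') c')
          + n2 * norm (cross3 c b - cross3 c' b') + n3 * norm (c - c')"
      using n by (simp flip: scaleR_diff_right)
    also have "\<dots> \<le> n1 * (W * s) + n2 * (U * s) + n3 * (P * s)"
      using n u w c by (intro add_mono mult_left_mono)
    also have "\<dots> \<le> (n1 * W + n2 * U + n3 * P + 1) * s"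
      using s by (simp add: algebra_simps)
    finally show "norm (attitude_estimate g B c b - attitude_estimate g B c' b')
        \<le> (n1 * W + n2 * U + n3 * P + 1) * s" .
  qed
qed

lemma minus_mult_vec: "(- A) *v x = - (A *v x)" for A :: "real^'n^'m"
  using matrix_vector_mult_diff_rdistrib[of 0 A x] by simp

section \<open>Kinematics and convergence of the observer\<close>

text \<open>Transposing \<open>R t ** skew w\<close> gives
  \<open>- skew w ** transpose (R t)\<close>, and the minus sign swaps the factors of the cross
  product.\<close>

lemma body_frame_derivative:
  fixes R :: "real \<Rightarrow> real^3^3"
  assumes R': "(R has_vector_derivative R t ** skew w) (at t within S)"
    and y: "\<And>t. t \<in> S \<Longrightarrow> y t = transpose (R t) *v x" and "t \<in> S"
  shows "(y has_vector_derivative cross3 (y t) w) (at t within S)"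
proof -
  have "linear (\<lambda>A::real^3^3. transpose A *v x)"
  proof (rule linearI)
    fix A A' :: "real^3^3" and k :: real
    have "transpose (A + A') = transpose A + transpose A'" "transpose (k *\<^sub>R A) = k *\<^sub>R transpose A"
      by (simp_all add: transpose_def vec_eq_iff)
    then show "transpose (A + A') *v x = transpose A *v x + transpose A' *v x"
      "transpose (k *\<^sub>R A) *v x = k *\<^sub>R (transpose A *v x)"
      by (simp_all only: matrix_vector_mult_add_rdistrib scaleR_matrix_vector_assoc)
  qed
  then have "bounded_linear (\<lambda>A::real^3^3. transpose A *v x)"
    by (simp add: linear_conv_bounded_linear)
  from bounded_linear.has_vector_derivative[OF this R']
  have "(y has_vector_derivative transpose (R t ** skew w) *v x) (at t within S)"
    by (rule has_vector_derivative_transform[OF \<open>t \<in> S\<close> y, rotated])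
  also have "transpose (R t ** skew w) *v x = - (skew w *v (transpose (R t) *v x))"
    by (simp only: matrix_transpose_mul transpose_skew matrix_vector_mul_assoc [symmetric]
        minus_mult_vec)
  also have "\<dots> = cross3 (y t) w"
    using y[OF \<open>t \<in> S\<close>] cross_skew[of "y t" w] by (simp only: skew_mult_vec)
  finally show ?thesis .
qed

text \<open>The rate is chosen before the initial values, and \<open>C\<close> from them before any
  solution is given: this is stronger than one constant per solution.\<close>

theorem corollary2:
  fixes g B1 B3 :: real
    and B :: "real^3"
    and \<omega> a v \<gamma> \<beta> :: "real \<Rightarrow> real^3"
    and R :: "real \<Rightarrow> real^3^3"
    and K L M :: "real^3^3"
  assumes "g > 0"
    and "B1 > 0"
    and "B = vector [B1, 0, B3]"
    and "continuous_on {0..} \<omega>"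
    and "continuous_on {0..} a"
    and "\<And>t. t \<ge> 0 \<Longrightarrow> R t \<in> SO3"
    and "\<And>t. t \<ge> 0 \<Longrightarrow> (R has_vector_derivative (R t ** skew (\<omega> t))) (at t within {0..})"
    and "\<And>t. t \<ge> 0 \<Longrightarrow> \<gamma> t = g *\<^sub>R (transpose (R t) *v E3)"
    and "\<And>t. t \<ge> 0 \<Longrightarrow> \<beta> t = transpose (R t) *v B"
    and "\<And>t. t \<ge> 0 \<Longrightarrow>
           (v has_vector_derivative (cross3 (v t) (\<omega> t) + \<gamma> t + a t)) (at t within {0..})"
    and "positive_definite (sym_part K)"
    and "positive_definite (sym_part L)"
    and "positive_definite (sym_part M)"
  shows "\<exists>\<mu>>0. \<forall>v0 \<gamma>0 \<beta>0. \<exists>C>0. \<forall>vh \<gamma>h \<beta>h.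
           observer_solution K L M \<omega> a v \<beta> vh \<gamma>h \<beta>h \<and> vh 0 = v0 \<and> \<gamma>h 0 = \<gamma>0 \<and> \<beta>h 0 = \<beta>0 \<longrightarrow>
           (\<forall>t\<ge>0. norm (attitude_estimate g B (\<gamma>h t) (\<beta>h t) - R t) \<le> C * exp (- \<mu> * t))"
proof -
  note g = assms(1) and B1 = assms(2) and B = assms(3) and R = assms(6)
  obtain kK where kK: "kK > 0" "\<And>y. kK * (norm y)\<^sup>2 \<le> y \<bullet> (K *v y)"
    using positive_definite_coercive[OF assms(11)] by blast
  obtain kL where kL: "kL > 0" "\<And>y. kL * (norm y)\<^sup>2 \<le> y \<bullet> (L *v y)"
    using positive_definite_coercive[OF assms(12)] by blast
  obtain kM where kM: "kM > 0" "\<And>y. kM * (norm y)\<^sup>2 \<le> y \<bullet> (M *v y)"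
    using positive_definite_coercive[OF assms(13)] by blast
  define m where "m = min kK (min kL kM)"
  have m: "m > 0"
    using kK kL kM by (simp add: m_def)
  have m_le: "m * (norm y)\<^sup>2 \<le> k * (norm y)\<^sup>2" if "m \<le> k" for k and y :: "real^3"
    using that by (simp add: mult_right_mono)
  have coercive: "m * (norm y)\<^sup>2 \<le> y \<bullet> (K *v y)" "m * (norm y)\<^sup>2 \<le> y \<bullet> (L *v y)"
    "m * (norm y)\<^sup>2 \<le> y \<bullet> (M *v y)" for y
    using m_le[of kK y] m_le[of kL y] m_le[of kM y] kK(2)[of y] kL(2)[of y] kM(2)[of y]
    unfolding m_def by linarith+
  have \<beta>': "(\<beta> has_vector_derivative cross3 (\<beta> t) (\<omega> t)) (at t within {0..})" if "t \<ge> 0" for t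
    by (rule body_frame_derivative[OF assms(7)[OF that], where x = B]) (use that assms(9) in auto)
  have \<gamma>': "(\<gamma> has_vector_derivative cross3 (\<gamma> t) (\<omega> t)) (at t within {0..})" if "t \<ge> 0" for t
    by (rule body_frame_derivative[OF assms(7)[OF that], where x = "g *\<^sub>R E3"])
      (use that assms(8) in \<open>auto simp: matrix_vector_mult_scaleR\<close>)
  \<comment> \<open>\<open>cascade_decay\<close> gives rate \<open>m\<close> for squared norms,
    hence \<open>m / 2\<close> for norms.\<close>
  show ?thesis
  proof (rule exI[of _ "m / 2"], intro conjI allI)
    show "m / 2 > 0"
      using m by simp
  next
    fix v0 \<gamma>0 \<beta>0 :: "real^3"
    define e0 where "e0 = v0 - v 0"
    define z0 where "z0 = \<gamma>0 - \<gamma> 0 - L *v e0"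
    \<comment> \<open>\<open>V0\<close> is the initial value of the Lyapunov function.
      \<open>P\<close> adds the bounds for \<open>z\<close> and \<open>L *v e\<close>, whose sum is
      the error of \<open>\<gamma>h\<close>; \<open>Q\<close> is the initial error of
      \<open>\<beta>h\<close>.\<close>
    define V0 where "V0 = (norm z0)\<^sup>2 / m\<^sup>2 + (norm e0)\<^sup>2"
    define P where "P = m * sqrt V0 + onorm ((*v) L) * sqrt V0"
    define Q where "Q = norm (\<beta>0 - \<beta> 0)"
    have "V0 \<ge> 0"
      by (simp add: V0_def)
    then have "P \<ge> 0"
      using m by (simp add: P_def onorm_pos_le)
    have "Q \<ge> 0"
      by (simp add: Q_def)
    obtain C where C: "C > 0"
      "\<And>c c' b b' s. \<lbrakk>norm (c - c') \<le> P * s; norm (b - b') \<le> Q * s;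
          norm c' \<le> g; norm b' \<le> norm B; 0 \<le> s; s \<le> 1\<rbrakk>
        \<Longrightarrow> norm (attitude_estimate g B c b - attitude_estimate g B c' b') \<le> C * s"
      by (rule attitude_estimate_perturbation
          [OF less_imp_le[OF g] norm_ge_zero \<open>P \<ge> 0\<close> \<open>Q \<ge> 0\<close> that])
    show "\<exists>C>0. \<forall>vh \<gamma>h \<beta>h.
           observer_solution K L M \<omega> a v \<beta> vh \<gamma>h \<beta>h \<and> vh 0 = v0 \<and> \<gamma>h 0 = \<gamma>0 \<and> \<beta>h 0 = \<beta>0 \<longrightarrow>
           (\<forall>t\<ge>0. norm (attitude_estimate g B (\<gamma>h t) (\<beta>h t) - R t) \<le> C * exp (- (m / 2) * t))"
    proof (intro exI[of _ C] conjI allI impI C(1))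
      fix vh \<gamma>h \<beta>h and t :: real
      assume sol: "observer_solution K L M \<omega> a v \<beta> vh \<gamma>h \<beta>h \<and> vh 0 = v0 \<and> \<gamma>h 0 = \<gamma>0 \<and> \<beta>h 0 = \<beta>0"
        and t: "t \<ge> 0"
      define s where "s = exp (- (m / 2) * t)"
      have s: "0 \<le> s" "s \<le> 1" "exp (- (m * t)) = s\<^sup>2"
        using m t by (simp_all add: s_def exp_double [symmetric])
      define e where "e = (\<lambda>t. vh t - v t)"
      define z where "z = (\<lambda>t. \<gamma>h t - \<gamma> t - L *v e t)"
      define q where "q = (\<lambda>t. \<beta>h t - \<beta> t)"
      have e': "(e has_vector_derivative cross3 (e t) (\<omega> t) + z t - K *v e t) (at t within {0..})"
        if "t \<ge> 0" for t
      proof -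
        have "(e has_vector_derivative
            cross3 (vh t) (\<omega> t) + a t + \<gamma>h t - (L + K) *v (vh t - v t)
            - (cross3 (v t) (\<omega> t) + \<gamma> t + a t)) (at t within {0..})"
          unfolding e_def using sol that assms(10)[OF that]
          by (intro has_vector_derivative_diff) (auto simp: observer_solution_def)
        then show ?thesis
          by (simp add: e_def z_def matrix_vector_mult_add_rdistrib Cross3.left_diff_distrib algebra_simps)
      qed
      have z': "(z has_vector_derivative cross3 (z t) (\<omega> t) - L *v z t) (at t within {0..})"
        if "t \<ge> 0" for t
      proof -
        have "(z has_vector_derivative
            cross3 (\<gamma>h t) (\<omega> t) - (L ** skew (\<omega> t) - skew (\<omega> t) ** L + L ** K) *v e t
            - cross3 (\<gamma> t) (\<omega> t) - L *v (cross3 (e t) (\<omega> t) + z t - K *v e t)) (at t within {0..})"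
          unfolding z_def using sol that \<gamma>'[OF that]
            bounded_linear.has_vector_derivative[OF matrix_vector_mul_bounded_linear e'[OF that], of L]
          by (intro has_vector_derivative_diff) (auto simp: observer_solution_def e_def z_def)
        moreover have "cross3 (\<gamma>h t) (\<omega> t)
            - (L ** skew (\<omega> t) - skew (\<omega> t) ** L + L ** K) *v e t
            - cross3 (\<gamma> t) (\<omega> t) - L *v (cross3 (e t) (\<omega> t) + z t - K *v e t)
            = cross3 (z t) (\<omega> t) - L *v z t"
        proof -
          \<comment> \<open>The commutator in the observer cancels
            \<open>L *v cross3 (e t) (\<omega> t)\<close> and supplies the rotation term of
            \<open>L *v e t\<close>; the \<open>L ** K\<close> term cancels the one coming from
            \<open>e'\<close>.\<close>
          have "(L ** skew (\<omega> t) - skew (\<omega> t) ** L + L ** K) *v e t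
              = L *v cross3 (\<omega> t) (e t) - cross3 (\<omega> t) (L *v e t) + L *v (K *v e t)"
            by (simp add: matrix_vector_mult_add_rdistrib matrix_vector_mult_diff_rdistrib
                matrix_vector_mul_assoc [symmetric] skew_mult_vec)
          moreover have "cross3 (\<omega> t) y = - cross3 y (\<omega> t)" for y
            by (rule cross_skew)
          ultimately show ?thesis
            by (simp add: z_def matrix_vector_mult_diff_distrib matrix_vector_right_distrib
                linear_neg[OF matrix_vector_mul_linear] Cross3.left_diff_distrib)
        qed
        ultimately show ?thesis
          by simp
      qed
      have q': "(q has_vector_derivative cross3 (q t) (\<omega> t) - M *v q t) (at t within {0..})"
        if "t \<ge> 0" for t
      proof -
        have "(q has_vector_derivative
            cross3 (\<beta>h t) (\<omega> t) - M *v (\<beta>h t - \<beta> t) - cross3 (\<beta> t) (\<omega> t)) (at t within {0..})"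
          unfolding q_def using sol that \<beta>'[OF that]
          by (intro has_vector_derivative_diff) (auto simp: observer_solution_def)
        then show ?thesis
          by (simp add: q_def Cross3.left_diff_distrib algebra_simps)
      qed
      have "(norm (z t))\<^sup>2 / m\<^sup>2 + (norm (e t))\<^sup>2 \<le> V0 * s\<^sup>2"
        using cascade_decay[OF e' z' coercive(1,2) m t] sol
        by (simp add: V0_def e0_def z0_def e_def z_def s(3))
      \<comment> \<open>Each nonnegative summand is bounded by the whole sum.\<close>
      then have "(norm (z t) / m)\<^sup>2 \<le> (sqrt V0 * s)\<^sup>2" "(norm (e t))\<^sup>2 \<le> (sqrt V0 * s)\<^sup>2"
        using zero_le_power2[of "norm (z t) / m"] zero_le_power2[of "norm (e t)"]
        unfolding power_mult_distrib power_divide real_sqrt_pow2[OF \<open>V0 \<ge> 0\<close>] by linarith+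
      then have "norm (z t) / m \<le> sqrt V0 * s" and e: "norm (e t) \<le> sqrt V0 * s"
        using \<open>V0 \<ge> 0\<close> s(1) by (auto intro: power2_le_imp_le)
      then have z: "norm (z t) \<le> m * (sqrt V0 * s)"
        using m by (simp add: field_simps)
      have "norm (L *v e t) \<le> onorm ((*v) L) * (sqrt V0 * s)"
        using onorm[OF matrix_vector_mul_bounded_linear, of L "e t"]
          mult_left_mono[OF e onorm_pos_le[OF matrix_vector_mul_bounded_linear, of L]] by linarith
      then have p: "norm (\<gamma>h t - \<gamma> t) \<le> P * s"
        using z norm_triangle_ineq[of "z t" "L *v e t"] by (simp add: z_def P_def algebra_simps)
      have "norm (q t) \<le> Q * s\<^sup>2"
        using rotating_decay[OF q' coercive(3) t] sol by (simp add: Q_def q_def s(3))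
      \<comment> \<open>One factor of \<open>s\<close> is given up to match the slower rate of the
        cascade.\<close>
      also have "\<dots> \<le> Q * s"
        using s \<open>Q \<ge> 0\<close> by (simp add: mult_left_mono power2_eq_square mult_left_le)
      finally have q: "norm (\<beta>h t - \<beta> t) \<le> Q * s"
        by (simp add: q_def)
      \<comment> \<open>Being rotated constant vectors, the true directions stay in the balls on
        which \<open>C\<close> was chosen.\<close>
      have "norm (\<gamma> t) \<le> g" "norm (\<beta> t) \<le> norm B"
        using assms(8,9)[OF t] SO3_norm[OF R[OF t]] g by simp_all
      moreover have "attitude_estimate g B (\<gamma> t) (\<beta> t) = R t"
        using attitude_estimate_true[OF R[OF t] g B1 B] assms(8,9)[OF t] by simp
      ultimately show "norm (attitude_estimate g B (\<gamma>h t) (\<beta>h t) - R t) \<le> C * exp (- (m / 2) * t)"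
        using C(2)[OF p q _ _ s(1,2)] by (simp add: s_def)
    qed
  qed
qed

end
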